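(* For every positive integer $n$, there is a protocol by which $3$ agents in the synchronous model explore the infinite $n$-dimensional oriented grid, i.e., every cell of $\mathbb{Z}^n$ is eventually visited by some agent. Likewise, for every positive integer $n$, there is a protocol by which $4$ agents in the semi-synchronous model explore the infinite $n$-dimensional oriented grid.
   Context: The $n$-dimensional grid has vertex set (cells) $\mathbb{Z}^n$; two cells are adjacent if they differ by exactly $1$ in exactly one coordinate. The grid is oriented: from each cell an agent can move in any of the $2n$ global directions $(\pm 1, i)$, $i\in\{1,\dots,n\}$ (changing coordinate $i$ by $\pm 1$), or stay. There are $m$ agents, all initially in the same cell (the origin); agents cannot distinguish cells. Each agent is governed by the same deterministic finite automaton (with a finite state set $Q$), though agents may start in different initial states. The transition function has the form $\delta: Q\times 2^Q \to Q\times(\{-1,+1\}\times\{0,1,\dots,n\})$: an agent in state $q$ observes the set of states of agents currently occupying its cell and moves to a new state and to the neighboring cell in the chosen direction (dimension $0$ meaning stay). Time proceeds in discrete steps; in each step each active agent performs an atomic look-compute-move cycle. In the synchronous model all agents are active in every step; in the semi-synchronous model an adversary (knowing everything about the agents) chooses in each step an arbitrary subset of agents to be active, subject only to each agent being active infinitely often. The grid is explored if every cell is eventually visited by some agent (the protocol must achieve this for every admissible schedule in the semi-synchronous model). *)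

theory Defs
  imports Main
begin

(* Cells of Z^n: functions nat => int that vanish outside the coordinates {1..n}.
   Automaton states are natural numbers, drawn from a finite set Q.
   A move is a pair (s, d) with s in {-1,+1} and d in {0..n}; d = 0 means stay,
   otherwise coordinate d is changed by s. *)

type_synonym cell = "nat \<Rightarrow> int"
type_synonym state = nat
type_synonym move = "int \<times> nat"
type_synonym delta = "state \<Rightarrow> state set \<Rightarrow> state \<times> move"
type_synonym config = "nat \<Rightarrow> state \<times> cell"

definition is_cell :: "nat \<Rightarrow> cell \<Rightarrow> bool" where
  "is_cell n c \<longleftrightarrow> (\<forall>j. j \<notin> {1..n} \<longrightarrow> c j = 0)"

definition origin :: cell where
  "origin = (\<lambda>_. 0)"

definition move_cell :: "cell \<Rightarrow> move \<Rightarrow> cell" where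
  "move_cell c mv = (if snd mv = 0 then c else c (snd mv := c (snd mv) + fst mv))"

definition protocol :: "nat \<Rightarrow> nat \<Rightarrow> state set \<Rightarrow> delta \<Rightarrow> (nat \<Rightarrow> state) \<Rightarrow> bool" where
  "protocol n m Q \<delta> init \<longleftrightarrow>
     finite Q \<and> (\<forall>i<m. init i \<in> Q) \<and>
     (\<forall>q\<in>Q. \<forall>S. S \<subseteq> Q \<longrightarrow>
        fst (\<delta> q S) \<in> Q \<and> fst (snd (\<delta> q S)) \<in> {-1, 1} \<and> snd (snd (\<delta> q S)) \<in> {0..n})"

definition observed :: "nat \<Rightarrow> config \<Rightarrow> cell \<Rightarrow> state set" where
  "observed m cfg p = {fst (cfg j) | j. j < m \<and> snd (cfg j) = p}"

definition step :: "nat \<Rightarrow> delta \<Rightarrow> nat set \<Rightarrow> config \<Rightarrow> config" where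
  "step m \<delta> A cfg = (\<lambda>i. if i \<in> A then
      (let (q, p) = cfg i; (q', mv) = \<delta> q (observed m cfg p) in (q', move_cell p mv))
    else cfg i)"

primrec run :: "nat \<Rightarrow> delta \<Rightarrow> (nat \<Rightarrow> state) \<Rightarrow> (nat \<Rightarrow> nat set) \<Rightarrow> nat \<Rightarrow> config" where
  "run m \<delta> init sched 0 = (\<lambda>i. (init i, origin))"
| "run m \<delta> init sched (Suc t) = step m \<delta> (sched t) (run m \<delta> init sched t)"

definition sync_sched :: "nat \<Rightarrow> nat \<Rightarrow> nat set" where
  "sync_sched m = (\<lambda>_. {..<m})"

definition fair_sched :: "nat \<Rightarrow> (nat \<Rightarrow> nat set) \<Rightarrow> bool" where
  "fair_sched m sched \<longleftrightarrow> (\<forall>t. sched t \<subseteq> {..<m}) \<and> (\<forall>i<m. infinite {t. i \<in> sched t})"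

definition explores :: "nat \<Rightarrow> nat \<Rightarrow> delta \<Rightarrow> (nat \<Rightarrow> state) \<Rightarrow> (nat \<Rightarrow> nat set) \<Rightarrow> bool" where
  "explores n m \<delta> init sched \<longleftrightarrow>
     (\<forall>c. is_cell n c \<longrightarrow> (\<exists>t i. i < m \<and> snd (run m \<delta> init sched t i) = c))"

end

theory Submission
  imports Defs "HOL-Library.Countable" "HOL-Computational_Algebra.Primes"
begin

text \<open>The agents move together as a robot with an unbounded register: the register is the distance
  between two agents along the first axis, and a third agent shuttles between them. Three
  synchronous agents multiply the register by a fraction in one round trip, if one of them drifts at
  a suitable average speed; four semi-synchronous agents do it by transferring units between two
  counters. Fractions suffice to maintain several counters, as exponents of distinct primes, so the
  robot can sweep ever larger boxes by nested loops.\<close>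

section \<open>Automata over countable state types\<close>

text \<open>Finite states cannot record how large a box has been searched, so the unbounded memory
  must lie in the relative positions of the agents. It survives a move because all agents eventually
  make the same move. A single distance \<open>k\<close> has to carry 2n counters: this is Minsky's
  Goedel numbering of counter machines, in the fraction form of Conway's FRACTRAN. A counter is zero
  iff its prime does not divide \<open>k\<close>, a test that needs only \<open>k\<close> modulo
  \<open>L\<close>, which the head can count in its finite state. A semi-synchronous adversary
  destroys the notion of speed on which the synchronous multiplication rests; hence the fourth agent
  and a handshake by presence in a cell. Both teams implement the same \<open>robot_step\<close>, so
  the search is programmed only once.\<close>

definition obs :: "nat \<Rightarrow> (nat \<Rightarrow> 's \<times> cell) \<Rightarrow> cell \<Rightarrow> 's set" where
  "obs m c p = {fst (c j) | j. j < m \<and> snd (c j) = p}"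

definition tstep ::
  "nat \<Rightarrow> ('s \<Rightarrow> 's set \<Rightarrow> 's \<times> move) \<Rightarrow> nat set \<Rightarrow> (nat \<Rightarrow> 's \<times> cell) \<Rightarrow> nat \<Rightarrow> 's \<times> cell" where
  "tstep m \<delta> A c = (\<lambda>i. if i \<in> A then
      (fst (\<delta> (fst (c i)) (obs m c (snd (c i)))),
       move_cell (snd (c i)) (snd (\<delta> (fst (c i)) (obs m c (snd (c i))))))
    else c i)"

primrec trun ::
  "nat \<Rightarrow> ('s \<Rightarrow> 's set \<Rightarrow> 's \<times> move) \<Rightarrow> (nat \<Rightarrow> 's) \<Rightarrow> (nat \<Rightarrow> nat set) \<Rightarrow> nat \<Rightarrow> nat \<Rightarrow> 's \<times> cell" where
  "trun m \<delta> init sched 0 = (\<lambda>i. (init i, origin))"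
| "trun m \<delta> init sched (Suc t) = tstep m \<delta> (sched t) (trun m \<delta> init sched t)"

definition encode :: "('s::countable \<Rightarrow> 's set \<Rightarrow> 's \<times> move) \<Rightarrow> delta" where
  "encode \<delta> = (\<lambda>x S. map_prod to_nat id (\<delta> (from_nat x) (from_nat ` S)))"

text \<open>Observed states are codes, on which \<open>from_nat\<close> inverts
  \<open>to_nat\<close>, so both automata run in lockstep. The protocols can therefore be written
  over datatypes.\<close>

lemma run_encode:
  fixes init :: "nat \<Rightarrow> 's::countable"
  shows "run m (encode \<delta>) (to_nat \<circ> init) sched t = (\<lambda>i. map_prod to_nat id (trun m \<delta> init sched t i))"
proof (induction t)
  case (Suc t)
  define c where "c = trun m \<delta> init sched t"
  have "from_nat ` observed m (\<lambda>i. map_prod to_nat id (c i)) p = obs m c p" for p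
    unfolding observed_def obs_def image_def by (auto; metis from_nat_to_nat)
  then have step: "step m (encode \<delta>) A (\<lambda>i. map_prod to_nat id (c i))
      = (\<lambda>i. map_prod to_nat id (tstep m \<delta> A c i))" for A
    by (intro ext) (auto simp: step_def tstep_def encode_def Let_def map_prod_def split: prod.splits)
  show ?case by (simp only: run.simps trun.simps Suc.IH step flip: c_def)
qed auto

lemma protocol_encode:
  fixes init :: "nat \<Rightarrow> 's::countable"
  assumes "finite Q" and "\<And>i. i < m \<Longrightarrow> init i \<in> Q"
    and "\<And>q S. q \<in> Q \<Longrightarrow> S \<subseteq> Q \<Longrightarrow>
      fst (\<delta> q S) \<in> Q \<and> fst (snd (\<delta> q S)) \<in> {-1, 1} \<and> snd (snd (\<delta> q S)) \<le> n"
  shows "protocol n m (to_nat ` Q) (encode \<delta>) (to_nat \<circ> init)"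
proof -
  have "from_nat ` S \<subseteq> Q" if "S \<subseteq> to_nat ` Q" for S
    using that by auto
  then show ?thesis
    using assms by (auto simp: protocol_def encode_def)
qed

lemma explores_encode:
  assumes "\<And>c. is_cell n c \<Longrightarrow> \<exists>t. \<exists>i<m. snd (trun m \<delta> init sched t i) = c"
  shows "explores n m (encode \<delta>) (to_nat \<circ> init) sched"
  using assms by (auto simp: explores_def run_encode)

section \<open>Moves along the first axis\<close>

definition shift :: "cell \<Rightarrow> int \<Rightarrow> cell" where
  "shift p x = p(1 := p 1 + x)"

lemma shift_0 [simp]: "shift p 0 = p"
  by (simp add: shift_def)

lemma shift_eq_iff [simp]: "shift p x = shift p y \<longleftrightarrow> x = y"
  by (auto simp: shift_def fun_eq_iff)

lemma shift_eq_self [simp]: "shift p x = p \<longleftrightarrow> x = 0" "p = shift p x \<longleftrightarrow> x = 0"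
  by (auto simp: shift_def fun_eq_iff)

lemma shift_shift [simp]: "shift (shift p x) y = shift p (x + y)"
  by (auto simp: shift_def fun_eq_iff)

lemma move_cell_axis: "move_cell p (s, Suc 0) = shift p s"
  by (auto simp: shift_def move_cell_def)

lemma move_cell_stay [simp]: "move_cell p (s, 0) = p"
  by (simp add: move_cell_def)

text \<open>Translations commute: an agent that copies the move of the base keeps its offset, even
  for moves along axis 1.\<close>

lemma move_cell_shift: "move_cell (shift p x) d = shift (move_cell p d) x"
  by (auto simp: shift_def move_cell_def fun_eq_iff)

section \<open>Robots with a multiplicative register\<close>

text \<open>A robot at cell \<open>p\<close> holds a register \<open>k > 0\<close>. An instruction is a control state together with
  the residue of \<open>k\<close> modulo \<open>L\<close>; it replaces \<open>k\<close> by \<open>k / den * num\<close>.\<close>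

locale fraction_robot =
  fixes n L M :: nat and K :: "'c::countable set"
    and den num :: "'c \<times> nat \<Rightarrow> nat" and mv :: "'c \<times> nat \<Rightarrow> move" and nxt :: "'c \<times> nat \<Rightarrow> 'c"
  assumes n: "n \<ge> 1" and L: "L > 0" and fin: "finite K"
    and den: "\<And>x. x \<in> K \<times> {..<L} \<Longrightarrow> 0 < den x \<and> den x \<le> M \<and> den x dvd L \<and> den x dvd snd x"
    and num: "\<And>x. x \<in> K \<times> {..<L} \<Longrightarrow> 0 < num x \<and> num x \<le> M"
    and mv: "\<And>x. x \<in> K \<times> {..<L} \<Longrightarrow> fst (mv x) \<in> {-1, 1} \<and> snd (mv x) \<le> n"
    and nxt: "\<And>x. x \<in> K \<times> {..<L} \<Longrightarrow> nxt x \<in> K"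
begin

definition robot_step :: "'c \<times> nat \<times> cell \<Rightarrow> 'c \<times> nat \<times> cell" where
  "robot_step = (\<lambda>(q, k, p). let x = (q, k mod L) in
     (nxt x, k div den x * num x, move_cell p (mv x)))"

definition reach :: "'c \<times> nat \<times> cell \<Rightarrow> 'c \<times> nat \<times> cell \<Rightarrow> bool" where
  "reach = (\<lambda>x y. y = robot_step x)\<^sup>*\<^sup>*"

definition valid :: "'c \<times> nat \<times> cell \<Rightarrow> bool" where
  "valid = (\<lambda>(q, k, p). q \<in> K \<and> k > 0)"

text \<open>As \<open>den x\<close> divides \<open>L\<close>, divisibility of \<open>k\<close> is
  visible in its residue; the division in \<open>robot_step\<close> is thus exact.\<close>

lemma den_dvd: "q \<in> K \<Longrightarrow> den (q, k mod L) dvd k"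
  using den[of "(q, k mod L)"] L by (auto simp: dvd_mod_iff)

lemma valid_step: "valid x \<Longrightarrow> valid (robot_step x)"
  using den num nxt den_dvd L
  by (fastforce simp: valid_def robot_step_def Let_def div_greater_zero_iff dvd_imp_le split: prod.splits)


lemma reach_refl [simp]: "reach x x"
  by (simp add: reach_def)

lemma reach_trans [trans]: "reach x y \<Longrightarrow> reach y z \<Longrightarrow> reach x z"
  by (simp add: reach_def)

lemma reach_step: "robot_step x = y \<Longrightarrow> reach x y"
  by (auto simp: reach_def)

lemma reach_induct [consumes 1, case_names refl step]:
  assumes "reach x y" "P x" "\<And>y. reach x y \<Longrightarrow> P y \<Longrightarrow> P (robot_step y)"
  shows "P y"
  using assms unfolding reach_def by (induction rule: rtranclp_induct) auto

lemma valid_reach: "reach x y \<Longrightarrow> valid x \<Longrightarrow> valid y"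
  by (induction rule: reach_induct) (auto intro: valid_step)

end

section \<open>Three synchronous agents\<close>

text \<open>In every period of length \<open>a + b\<close> the cycling agent makes \<open>b\<close> steps outwards and \<open>a\<close> steps back.
  Hence it stays on or above the line of slope \<open>(b - a) / (b + a)\<close>, on which it lies at full periods.\<close>

definition cyc :: "nat \<Rightarrow> nat \<Rightarrow> nat \<Rightarrow> int" where
  "cyc a b t = (int b - int a) * int (t div (a + b)) +
     (if t mod (a + b) \<le> b then int (t mod (a + b)) else 2 * int b - int (t mod (a + b)))"

lemma cyc_0 [simp]: "cyc a b 0 = 0"
  by (simp add: cyc_def)

lemma cyc_Suc:
  assumes "0 < a" "0 < b"
  shows "cyc a b (Suc t) = cyc a b t + (if t mod (a + b) < b then 1 else - 1)"
proof (cases "Suc t mod (a + b) = 0")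
  case True
  then have m: "t mod (a + b) = a + b - 1" and d: "Suc t div (a + b) = Suc (t div (a + b))"
    using assms by (auto simp: mod_Suc div_Suc split: if_splits)
  show ?thesis unfolding cyc_def d True m using assms by (auto simp: algebra_simps of_nat_diff)
next
  case False
  then have m: "Suc t mod (a + b) = Suc (t mod (a + b))" and d: "Suc t div (a + b) = t div (a + b)"
    by (auto simp: mod_Suc div_Suc split: if_splits)
  show ?thesis unfolding cyc_def d m by auto
qed

lemma cyc_full: "cyc a b ((a + b) * j) = (int b - int a) * int j"
  by (cases "a + b = 0") (auto simp: cyc_def)

text \<open>Full periods lie on the line, so only the phase counts. Outwards the path is steeper
  than the line; on the way back it descends to it and arrives at the end of the period.\<close>

lemma cyc_above_line:
  assumes "0 < a" "0 < b"
  shows "(int b - int a) * int t \<le> (int a + int b) * cyc a b t"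
proof -
  define i m where "i = t mod (a + b)" and "m = t div (a + b)"
  have t: "int t = (int a + int b) * int m + int i"
    unfolding i_def m_def by (metis mult_div_mod_eq of_nat_add of_nat_mult)
  have i: "int i \<le> int a + int b"
    using assms mod_less_divisor[of "a + b" t] unfolding i_def by linarith
  have "(int b - int a) * int i \<le> (int a + int b) * (if i \<le> b then int i else 2 * int b - int i)"
  proof (cases "i \<le> b")
    case True
    then show ?thesis by (auto intro!: mult_right_mono)
  next
    case False
    \<comment> \<open>The scaled height above the line is \<open>2 * b\<close> times the number of
      steps left in the period.\<close>
    have "0 \<le> 2 * int b * (int a + int b - int i)" using i by simp
    also have "\<dots> = (int a + int b) * (2 * int b - int i) - (int b - int a) * int i"
      by (simp add: algebra_simps)
    finally show ?thesis using False by simp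
  qed
  then show ?thesis
    unfolding t cyc_def i_def[symmetric] m_def[symmetric] by (simp add: algebra_simps)
qed

text \<open>A head that walks in from distance \<open>a * j\<close> and out again has position
  \<open>t - a * j\<close> at time \<open>t\<close>. This path meets the line of the cycling agent
  at time \<open>(a + b) * j\<close>; staying above that line excludes an earlier meeting.\<close>

lemma cyc_ahead:
  assumes "0 < a" "0 < b" "t < (a + b) * j"
  shows "int t - int (a * j) < int (a * j) + cyc a b t"
proof -
  have "(int a + int b) * (int t - int (a * j) - int (a * j) - cyc a b t)
      \<le> (int a + int b) * (int t - 2 * int a * int j) - (int b - int a) * int t"
    using cyc_above_line[OF assms(1,2), of t] by (simp add: algebra_simps)
  also have "\<dots> = 2 * int a * (int t - (int a + int b) * int j)"
    by (simp add: algebra_simps)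
  also have "\<dots> < 0"
    using assms by (intro mult_pos_neg) (auto simp flip: of_nat_add of_nat_mult)
  finally show ?thesis using assms by (simp add: mult_less_0_iff)
qed

section \<open>The synchronous automaton and one round trip of its head\<close>

datatype 'c sstate =
  Base | Cycling "'c \<times> nat" nat | Inward "'c \<times> nat" | Outward "'c \<times> nat"

instance sstate :: (countable) countable
  by countable_datatype

lemma obs_3: "obs 3 c p =
    {x. x = fst (c 0) \<and> snd (c 0) = p \<or> x = fst (c 1) \<and> snd (c 1) = p \<or> x = fst (c 2) \<and> snd (c 2) = p}"
  unfolding obs_def by (auto simp: less_Suc_eq numeral_3_eq_3 numeral_2_eq_2)

context fraction_robot
begin

text \<open>The agents carry out \<open>mv\<close> at different times: the cycling agent when the
  head hands it the instruction, base and head when the head is back. \<open>Outward\<close> counts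
  the distance modulo \<open>L\<close>, so the residue is known on arrival.\<close>

fun sync_delta :: "'c sstate \<Rightarrow> 'c sstate set \<Rightarrow> 'c sstate \<times> move" where
  "sync_delta Base S = (Base, if \<exists>x. Inward x \<in> S then mv (SOME x. Inward x \<in> S) else (1, 0))"
| "sync_delta (Cycling x i) S =
    (if \<exists>y. Outward y \<in> S then (let y = SOME y. Outward y \<in> S in (Cycling y 0, mv y))
     else (Cycling x (Suc i mod (den x + num x)), if i < num x then (1, 1) else (-1, 1)))"
| "sync_delta (Inward x) S =
    (if Base \<in> S then (Outward (nxt x, 0), mv x) else (Inward x, (-1, 1)))"
| "sync_delta (Outward x) S =
    (if \<exists>y i. Cycling y i \<in> S then (Inward x, (-1, 1))
     else (Outward (fst x, Suc (snd x) mod L), (1, 1)))"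

definition sync_states :: "'c sstate set" where
  "sync_states = insert Base (case_prod Cycling ` ((K \<times> {..<L}) \<times> {..2 * M})
     \<union> Inward ` (K \<times> {..<L}) \<union> Outward ` (K \<times> {..<L}))"

lemma sync_states_iff [simp]:
  "Base \<in> sync_states"
  "Cycling x i \<in> sync_states \<longleftrightarrow> x \<in> K \<times> {..<L} \<and> i \<le> 2 * M"
  "Inward x \<in> sync_states \<longleftrightarrow> x \<in> K \<times> {..<L}"
  "Outward x \<in> sync_states \<longleftrightarrow> x \<in> K \<times> {..<L}"
  by (auto simp: sync_states_def)

lemma finite_sync_states: "finite sync_states"
  using fin by (auto simp: sync_states_def)

lemma sync_delta_closed:
  assumes "q \<in> sync_states" and S: "S \<subseteq> sync_states"
  shows "fst (sync_delta q S) \<in> sync_states \<and> fst (snd (sync_delta q S)) \<in> {-1, 1}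
    \<and> snd (snd (sync_delta q S)) \<le> n"
proof -
  have inw: "(SOME x. Inward x \<in> S) \<in> K \<times> {..<L}" if "\<exists>x. Inward x \<in> S"
    using someI_ex[OF that] S sync_states_iff(3) by blast
  have outw: "(SOME x. Outward x \<in> S) \<in> K \<times> {..<L}" if "\<exists>x. Outward x \<in> S"
    using someI_ex[OF that] S sync_states_iff(4) by blast
  show ?thesis
  proof (cases q)
    case Base
    then show ?thesis using inw mv n by auto
  next
    case (Cycling x i)
    then have x: "x \<in> K \<times> {..<L}" using assms by auto
    then have "den x + num x \<le> 2 * M" "0 < den x + num x" using den[OF x] num[OF x] by auto
    then have "Suc i mod (den x + num x) \<le> 2 * M"
      by (meson le_trans less_imp_le mod_less_divisor)
    then show ?thesis using Cycling x outw mv[OF outw] n by (auto simp: Let_def)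
  next
    case (Inward x)
    then have x: "x \<in> K \<times> {..<L}" using assms by auto
    then show ?thesis using Inward mv[OF x] nxt[OF x] n L by auto
  next
    case (Outward x)
    then show ?thesis using assms n L by auto
  qed
qed

text \<open>The program of the cycling agent may be arbitrary here, since the head overwrites it in
  the next step.\<close>

definition sync_config :: "'c \<times> nat \<times> cell \<Rightarrow> (nat \<Rightarrow> 'c sstate \<times> cell) \<Rightarrow> bool" where
  "sync_config = (\<lambda>(q, k, p) c. c 0 = (Base, p) \<and> (\<exists>x i. c 1 = (Cycling x i, shift p (int k)))
     \<and> c 2 = (Outward (q, k mod L), shift p (int k)))"

abbreviation sync_next :: "(nat \<Rightarrow> 'c sstate \<times> cell) \<Rightarrow> nat \<Rightarrow> 'c sstate \<times> cell" where
  "sync_next \<equiv> tstep 3 sync_delta {..<3}"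

text \<open>With \<open>k = a * j\<close>, the head needs \<open>(a + b) * j\<close> steps to go in
  and then out to distance \<open>b * j\<close>. In that time the cycling agent completes
  \<open>j\<close> periods and drifts from \<open>a * j\<close> by \<open>(b - a) * j\<close> to the
  same cell.\<close>

lemma sync_step:
  assumes "valid s" "sync_config s c"
  shows "\<exists>t. sync_config (robot_step s) ((sync_next ^^ t) c)"
proof -
  obtain q k p where s: "s = (q, k, p)" by (cases s)
  define x where "x = (q, k mod L)"
  define a b d where "a = den x" and "b = num x" and "d = mv x"
  define p' where "p' = move_cell p d"
  obtain j where kj: "k = a * j"
    using den_dvd[of q k] assms(1) unfolding s valid_def a_def x_def by auto
  have xK: "x \<in> K \<times> {..<L}" using assms(1) L by (auto simp: s valid_def x_def)
  have ab: "0 < a" "0 < b" using den[OF xK] num[OF xK] by (auto simp: a_def b_def)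
  have k: "0 < k" using assms(1) by (auto simp: s valid_def)
  have j: "0 < j" using k kj by simp
  define C where "C t = (sync_next ^^ t) c" for t
  have C_Suc: "C (Suc t) = sync_next (C t)" for t by (simp add: C_def)
  obtain y i where c: "c 0 = (Base, p)" "c (Suc 0) = (Cycling y i, shift p (int k))"
      "c 2 = (Outward x, shift p (int k))"
    using assms(2) by (auto simp: s sync_config_def x_def)
  \<comment> \<open>The first step delivers the instruction, so the clock of \<open>cyc\<close>
    starts one step late.\<close>
  have inward: "C (Suc t) 0 = (Base, p) \<and>
      C (Suc t) 1 = (Cycling x (t mod (a + b)), shift p' (int k + cyc a b t)) \<and>
      C (Suc t) 2 = (Inward x, shift p (int k - 1 - int t))" if "t < k" for t
    using that
  proof (induction t)
    case 0
    show ?case using c k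
      by (auto simp: C_def tstep_def obs_3 move_cell_axis p'_def d_def move_cell_shift)
  next
    case (Suc t)
    then have *: "C (Suc t) 0 = (Base, p)"
      "C (Suc t) (Suc 0) = (Cycling x (t mod (a + b)), shift p' (int k + cyc a b t))"
      "C (Suc t) 2 = (Inward x, shift p (int k - 1 - int t))" by auto
    have "int k - 1 - int t \<noteq> 0" using Suc.prems by linarith
    then show ?case
      using * ab by (subst (1 2 3) C_Suc)
        (auto simp: tstep_def obs_3 move_cell_axis cyc_Suc mod_Suc_eq algebra_simps
          simp flip: a_def b_def)
  qed
  have outward: "C (Suc (k + t)) 0 = (Base, p') \<and>
      C (Suc (k + t)) 1 = (Cycling x ((k + t) mod (a + b)), shift p' (int k + cyc a b (k + t))) \<and>
      C (Suc (k + t)) 2 = (Outward (nxt x, t mod L), shift p' (int t))" if "t \<le> b * j" for t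
    using that
  proof (induction t)
    case 0
    define i where "i = k - 1"
    have ki: "k = Suc i" using k by (simp add: i_def)
    have "C (Suc i) 0 = (Base, p)"
      "C (Suc i) (Suc 0) = (Cycling x (i mod (a + b)), shift p' (int k + cyc a b i))"
      "C (Suc i) 2 = (Inward x, p)" using inward[of i] by (auto simp: ki)
    then show ?case
      using ab by (subst (1 2 3) C_Suc)
        (auto simp: ki tstep_def obs_3 move_cell_axis cyc_Suc mod_Suc_eq algebra_simps p'_def d_def
          simp flip: a_def b_def)
  next
    case (Suc t)
    then have *: "C (Suc (k + t)) 0 = (Base, p')"
      "C (Suc (k + t)) (Suc 0) = (Cycling x ((k + t) mod (a + b)), shift p' (int k + cyc a b (k + t)))"
      "C (Suc (k + t)) 2 = (Outward (nxt x, t mod L), shift p' (int t))" by auto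
    \<comment> \<open>The head is still strictly behind, so it does not turn early.\<close>
    have "int k + cyc a b (k + t) \<noteq> int t"
      using cyc_ahead[of a b "k + t" j] ab Suc.prems by (auto simp: kj algebra_simps)
    then show ?case
      using * ab by (simp add: C_Suc[of "Suc (k + t)"])
        (auto simp: tstep_def obs_3 move_cell_axis cyc_Suc mod_Suc_eq algebra_simps
          simp flip: a_def b_def)
  qed
  have kt: "k + b * j = (a + b) * j" by (simp add: kj algebra_simps)
  have "int k + cyc a b (k + b * j) = int (b * j)"
    unfolding kt cyc_full by (simp add: kj algebra_simps)
  moreover have "robot_step s = (nxt x, k div a * b, p')"
    by (simp add: s robot_step_def p'_def d_def a_def b_def x_def Let_def)
  then have "robot_step s = (nxt x, b * j, p')"
    using ab by (simp add: kj)
  ultimately show ?thesis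
    using outward[of "b * j"] by (intro exI[of _ "Suc (k + b * j)"]) (auto simp: sync_config_def C_def)
qed


lemma sync_reach:
  assumes "reach s s'" "valid s" "sync_config s c"
  shows "\<exists>t. sync_config s' ((sync_next ^^ t) c)"
  using assms(1)
proof (induction rule: reach_induct)
  case refl
  show ?case using assms(3) by (intro exI[of _ 0]) simp
next
  case (step y)
  then obtain t where "sync_config y ((sync_next ^^ t) c)" by blast
  from sync_step[OF valid_reach[OF step(1) assms(2)] this]
  obtain t' where "sync_config (robot_step y) ((sync_next ^^ (t' + t)) c)"
    by (auto simp: funpow_add)
  then show ?case by blast
qed

text \<open>In the degenerate first cycle the base steps back once, and the cycling agent
  meets the head at the origin, at distance 1 from the base.\<close>

lemma sync_exploration:
  assumes "ini \<in> K" "num (ini, 0) = 1" "den (ini, 0) = 1" "mv (ini, 0) = (-1, 1)"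
    and visits: "\<And>c. is_cell n c \<Longrightarrow> \<exists>q k. reach (nxt (ini, 0), 1, shift origin (-1)) (q, k, c)"
  shows "\<exists>Q \<delta> init. protocol n 3 Q \<delta> init \<and> explores n 3 \<delta> init (sync_sched 3)"
proof -
  define init :: "nat \<Rightarrow> 'c sstate" where "init i =
    (if i = 0 then Base else if i = 1 then Cycling (ini, 0) 0 else Inward (ini, 0))" for i
  define R where "R = trun 3 sync_delta init (sync_sched 3)"
  have R: "R t = (sync_next ^^ t) (R 0)" for t
    by (induction t) (auto simp: R_def sync_sched_def)
  have R_Suc: "R (Suc t) = sync_next (R t)" for t
    by (simp add: R_def sync_sched_def)
  have R0: "R 0 0 = (Base, origin)" "R 0 (Suc 0) = (Cycling (ini, 0) 0, origin)"
      "R 0 2 = (Inward (ini, 0), origin)"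
    by (auto simp: R_def init_def)
  \<comment> \<open>The backward step fixes a parity: with a staying base, the head would be at
    \<open>t - 1\<close> and the cycling agent at \<open>t mod 2\<close> at time
    \<open>t >= 1\<close>, and they would never meet.\<close>
  have R1: "R 1 0 = (Base, shift origin (-1))" "R 1 (Suc 0) = (Cycling (ini, 0) 1, shift origin 1)"
      "R 1 2 = (Outward (nxt (ini, 0), 0), shift origin (-1))"
    using R0 assms(2-4) unfolding One_nat_def R_Suc by (auto simp: tstep_def obs_3 move_cell_axis)
  have "R 2 0 = (Base, shift origin (-1)) \<and> R 2 1 = (Cycling (ini, 0) 0, origin) \<and>
      R 2 2 = (Outward (nxt (ini, 0), 1 mod L), origin)"
    using R1 assms(2-4) R_Suc[of 1] by (auto simp: tstep_def obs_3 move_cell_axis numeral_2_eq_2)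
  then have cfg: "sync_config (nxt (ini, 0), 1, shift origin (-1)) (R 2)"
    by (auto simp: sync_config_def)
  have val: "valid (nxt (ini, 0), 1, shift origin (-1))"
    using assms(1) nxt L by (auto simp: valid_def)
  have "\<exists>t. \<exists>i<3. snd (R t i) = c" if c: "is_cell n c" for c
  proof -
    obtain q k where "reach (nxt (ini, 0), 1, shift origin (-1)) (q, k, c)"
      using visits[OF c] by blast
    from sync_reach[OF this val cfg] obtain t where "sync_config (q, k, c) ((sync_next ^^ t) (R 2))"
      by blast
    then have "sync_config (q, k, c) (R (t + 2))"
      unfolding R[of "t + 2"] R[of 2] by (simp only: funpow_add o_apply)
    then have "snd (R (t + 2) 0) = c" by (simp add: sync_config_def)
    then show ?thesis by (intro exI[of _ "t + 2"] exI[of _ 0]) simp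
  qed
  then have "explores n 3 (encode sync_delta) (to_nat \<circ> init) (sync_sched 3)"
    unfolding R_def by (rule explores_encode)
  moreover have "protocol n 3 (to_nat ` sync_states) (encode sync_delta) (to_nat \<circ> init)"
    using assms(1) L finite_sync_states sync_delta_closed
    by (intro protocol_encode) (auto simp: init_def)
  ultimately show ?thesis by blast
qed

end

section \<open>Four semi-synchronous agents\<close>

text \<open>A head (agent 3) commands three marks: mark 0 sits at the base, the source mark stores the
  register as its distance from the base, and the target mark collects the new value on the other
  side of the base. The head waits until a commanded mark has left the cell, so that at any time
  the activation of only one agent changes the configuration. The Boolean argument of a
  program counter tells whether the source is mark 1, on the positive side.\<close>

datatype 'c pc =
  PushBase "'c \<times> nat" bool | PushTarget "'c \<times> nat" bool
| WalkOut "'c \<times> nat" bool | PushSource "'c \<times> nat" bool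
| Decr "'c \<times> nat" bool nat nat | WalkTarget "'c \<times> nat" bool nat
| Incr "'c \<times> nat" bool nat nat | WalkSource "'c \<times> nat" bool nat

text \<open>\<open>Push j m m' pc\<close> sends mark \<open>j\<close> away by \<open>m\<close>, then the head moves by \<open>m'\<close>.
  \<open>Walk m j pc pc0\<close> repeats \<open>m\<close> until mark \<open>j\<close> is met; \<open>pc0\<close> is chosen if mark 0 is there, too.\<close>

datatype 'c instr = Push nat move move "'c pc" | Walk move nat "'c pc" "'c pc"

datatype 'c astate = Mark nat | Head "'c pc"

instance pc :: (countable) countable
  by countable_datatype

instance astate :: (countable) countable
  by countable_datatype

definition source :: "bool \<Rightarrow> nat" where "source \<sigma> = (if \<sigma> then 1 else 2)"

definition side :: "bool \<Rightarrow> int" where "side \<sigma> = (if \<sigma> then 1 else -1)"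

lemma source_simps [simp]: "source \<sigma> \<noteq> 0" "source \<sigma> < 3" "source (\<not> \<sigma>) \<noteq> source \<sigma>" "source \<sigma> \<noteq> source (\<not> \<sigma>)"
  by (auto simp: source_def)

lemma side_simps [simp]: "side (\<not> \<sigma>) = - side \<sigma>" "side \<sigma> \<noteq> 0" "side \<sigma> = 1 \<or> side \<sigma> = -1"
  by (auto simp: side_def)

lemma move_cell_neq: "snd m \<noteq> 0 \<Longrightarrow> fst m \<noteq> 0 \<Longrightarrow> move_cell h m \<noteq> h"
  by (auto simp: move_cell_def fun_eq_iff)

lemma obs_4: "obs 4 c p =
    {x. x = fst (c 0) \<and> snd (c 0) = p \<or> x = fst (c 1) \<and> snd (c 1) = p \<or>
        x = fst (c 2) \<and> snd (c 2) = p \<or> x = fst (c 3) \<and> snd (c 3) = p}"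
proof -
  have *: "(\<exists>j<4. Q j) \<longleftrightarrow> Q 0 \<or> Q 1 \<or> Q 2 \<or> Q 3" for Q :: "nat \<Rightarrow> bool"
    by (simp add: eval_nat_numeral Ex_less_Suc disj_ac)
  have "x \<in> obs 4 c p \<longleftrightarrow> (\<exists>j<4. x = fst (c j) \<and> snd (c j) = p)" for x
    by (auto simp: obs_def)
  then show ?thesis unfolding * by blast
qed

context fraction_robot
begin

text \<open>The argument \<open>s\<close> is the residue of what the target has collected and
  becomes the \<open>k mod L\<close> of the next instruction; \<open>i\<close> counts units within a
  batch. The only zero test is in \<open>WalkSource\<close>: an empty source stands on mark
  0.\<close>

fun instr :: "'c pc \<Rightarrow> 'c instr" where
  "instr (PushBase x \<sigma>) = Push 0 (mv x) (1, 0) (PushTarget x \<sigma>)"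
| "instr (PushTarget x \<sigma>) = Push (source (\<not> \<sigma>)) (mv x) (1, 0) (WalkOut x \<sigma>)"
| "instr (WalkOut x \<sigma>) = Walk (side \<sigma>, 1) (source \<sigma>) (PushSource x \<sigma>) (PushSource x \<sigma>)"
| "instr (PushSource x \<sigma>) = Push (source \<sigma>) (mv x) (mv x) (Decr x \<sigma> 0 0)"
| "instr (Decr x \<sigma> s i) = Push (source \<sigma>) (- side \<sigma>, 1) (- side \<sigma>, 1)
     (if Suc i < den x then Decr x \<sigma> s (Suc i) else WalkTarget x \<sigma> s)"
| "instr (WalkTarget x \<sigma> s) =
     Walk (- side \<sigma>, 1) (source (\<not> \<sigma>)) (Incr x \<sigma> s 0) (Incr x \<sigma> s 0)"
| "instr (Incr x \<sigma> s i) = Push (source (\<not> \<sigma>)) (- side \<sigma>, 1) (- side \<sigma>, 1)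
     (if Suc i < num x then Incr x \<sigma> s (Suc i) else WalkSource x \<sigma> ((s + num x) mod L))"
| "instr (WalkSource x \<sigma> s) =
     Walk (side \<sigma>, 1) (source \<sigma>) (Decr x \<sigma> s 0) (PushBase (nxt x, s) (\<not> \<sigma>))"

text \<open>Marks need no memory: once moved, a mark is outside the head's cell, so it executes a
  command exactly once under any schedule. For a push by a stay the head must not wait, as the mark
  would never leave.\<close>

fun semi_delta :: "'c astate \<Rightarrow> 'c astate set \<Rightarrow> 'c astate \<times> move" where
  "semi_delta (Mark j) S = (Mark j,
     if \<exists>pc. Head pc \<in> S then
       (case instr (SOME pc. Head pc \<in> S) of
          Push j' m m' pc' \<Rightarrow> if j' = j then m else (1, 0)
        | Walk _ _ _ _ \<Rightarrow> (1, 0))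
     else (1, 0))"
| "semi_delta (Head pc) S = (case instr pc of
      Push j m m' pc' \<Rightarrow> if Mark j \<in> S \<and> snd m \<noteq> 0 then (Head pc, (1, 0)) else (Head pc', m')
    | Walk m j pc' pc0 \<Rightarrow>
        if Mark j \<in> S then (Head (if Mark 0 \<in> S then pc0 else pc'), (1, 0)) else (Head pc, m))"

definition pcs :: "'c pc set" where
  "pcs = (let X = K \<times> {..<L}; I = {..<L} \<times> {..M} in
     (\<Union>\<sigma>. (\<lambda>x. PushBase x \<sigma>) ` X \<union> (\<lambda>x. PushTarget x \<sigma>) ` X \<union> (\<lambda>x. WalkOut x \<sigma>) ` X \<union>
       (\<lambda>x. PushSource x \<sigma>) ` X \<union> (\<lambda>(x, s, i). Decr x \<sigma> s i) ` (X \<times> I) \<union>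
       (\<lambda>(x, s). WalkTarget x \<sigma> s) ` (X \<times> {..<L}) \<union> (\<lambda>(x, s, i). Incr x \<sigma> s i) ` (X \<times> I) \<union>
       (\<lambda>(x, s). WalkSource x \<sigma> s) ` (X \<times> {..<L})))"

lemma finite_pcs: "finite pcs"
  using fin by (auto simp: pcs_def Let_def)

lemma pcs_iff [simp]:
  "PushBase x \<sigma> \<in> pcs \<longleftrightarrow> x \<in> K \<times> {..<L}"
  "PushTarget x \<sigma> \<in> pcs \<longleftrightarrow> x \<in> K \<times> {..<L}"
  "WalkOut x \<sigma> \<in> pcs \<longleftrightarrow> x \<in> K \<times> {..<L}"
  "PushSource x \<sigma> \<in> pcs \<longleftrightarrow> x \<in> K \<times> {..<L}"
  "Decr x \<sigma> s i \<in> pcs \<longleftrightarrow> x \<in> K \<times> {..<L} \<and> s < L \<and> i \<le> M"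
  "WalkTarget x \<sigma> s \<in> pcs \<longleftrightarrow> x \<in> K \<times> {..<L} \<and> s < L"
  "Incr x \<sigma> s i \<in> pcs \<longleftrightarrow> x \<in> K \<times> {..<L} \<and> s < L \<and> i \<le> M"
  "WalkSource x \<sigma> s \<in> pcs \<longleftrightarrow> x \<in> K \<times> {..<L} \<and> s < L"
  by (auto simp: pcs_def Let_def image_iff)

lemma side_cases: "side \<sigma> \<in> {-1, 1}" "- side \<sigma> \<in> {-1, 1}"
  by (auto simp: side_def)

lemma instr_closed:
  assumes "pc \<in> pcs"
  shows "case instr pc of
      Push j m m' pc' \<Rightarrow> j < 3 \<and> fst m \<in> {-1, 1} \<and> snd m \<le> n \<and> fst m' \<in> {-1, 1} \<and> snd m' \<le> n \<and> pc' \<in> pcs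
    | Walk m j pc' pc0 \<Rightarrow> j < 3 \<and> fst m \<in> {-1, 1} \<and> snd m \<le> n \<and> pc' \<in> pcs \<and> pc0 \<in> pcs"
proof -
  have instruction: "fst (mv x) \<in> {-1, 1} \<and> snd (mv x) \<le> n \<and> nxt x \<in> K \<and>
      0 < den x \<and> den x \<le> M \<and> 0 < num x \<and> num x \<le> M" if "x \<in> K \<times> {..<L}" for x
    using mv[OF that] nxt[OF that] den[OF that] num[OF that] by blast
  show ?thesis
  proof (cases pc)
    case (PushBase x \<sigma>)
    then show ?thesis using assms n instruction[of x] by auto
  next
    case (PushTarget x \<sigma>)
    then show ?thesis using assms n instruction[of x] by auto
  next
    case (WalkOut x \<sigma>)
    then show ?thesis using assms n side_cases by auto
  next
    case (PushSource x \<sigma>)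
    then show ?thesis using assms n L instruction[of x] by auto
  next
    case (Decr x \<sigma> s i)
    then show ?thesis using assms n instruction[of x] side_cases by auto
  next
    case (WalkTarget x \<sigma> s)
    then show ?thesis using assms n side_cases by auto
  next
    case (Incr x \<sigma> s i)
    then show ?thesis using assms n L instruction[of x] side_cases by auto
  next
    case (WalkSource x \<sigma> s)
    then show ?thesis using assms n instruction[of x] side_cases by auto
  qed
qed

lemma semi_delta_closed:
  assumes "q \<in> Mark ` {..<3} \<union> Head ` pcs" and S: "S \<subseteq> Mark ` {..<3} \<union> Head ` pcs"
  shows "fst (semi_delta q S) \<in> Mark ` {..<3} \<union> Head ` pcs \<and>
    fst (snd (semi_delta q S)) \<in> {-1, 1} \<and> snd (snd (semi_delta q S)) \<le> n"
proof (cases q)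
  case (Mark j)
  show ?thesis
  proof (cases "\<exists>pc. Head pc \<in> S")
    case True
    then have "(SOME pc. Head pc \<in> S) \<in> pcs"
      using someI_ex[OF True] S by auto
    from instr_closed[OF this] show ?thesis
      using Mark True assms(1) by (auto split: instr.splits)
  next
    case False
    then show ?thesis using Mark assms(1) by auto
  qed
next
  case (Head pc)
  with assms(1) have "pc \<in> pcs" by auto
  from instr_closed[OF this] this show ?thesis
    using Head by (auto split: instr.splits)
qed

section \<open>Effect of arbitrary activation sets on marks and head\<close>

definition marked :: "(nat \<Rightarrow> cell) \<Rightarrow> cell \<Rightarrow> 'c pc \<Rightarrow> (nat \<Rightarrow> 'c astate \<times> cell) \<Rightarrow> bool" where
  "marked P h pc c \<longleftrightarrow>
     (\<forall>j<3. c j = (Mark j, P j)) \<and> c 3 = (Head pc, h)"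

abbreviation semi_next :: "nat set \<Rightarrow> (nat \<Rightarrow> 'c astate \<times> cell) \<Rightarrow> nat \<Rightarrow> 'c astate \<times> cell" where
  "semi_next \<equiv> tstep 4 semi_delta"

lemma obs_marked:
  assumes "marked P h pc c"
  shows "Head pc' \<in> obs 4 c p \<longleftrightarrow> pc' = pc \<and> p = h"
    and "j < 3 \<Longrightarrow> Mark j \<in> obs 4 c p \<longleftrightarrow> P j = p"
proof -
  have c: "c j = (Mark j, P j)" if "j < 3" for j
    using assms that by (auto simp: marked_def)
  have c3: "c 3 = (Head pc, h)" using assms by (simp add: marked_def)
  show "Head pc' \<in> obs 4 c p \<longleftrightarrow> pc' = pc \<and> p = h"
    by (auto simp: obs_4 c c3)
  show "Mark j \<in> obs 4 c p \<longleftrightarrow> P j = p" if "j < 3"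
  proof
    assume "Mark j \<in> obs 4 c p"
    then show "P j = p" by (auto simp: obs_4 c c3)
  next
    assume "P j = p"
    with that show "Mark j \<in> obs 4 c p"
      unfolding obs_def by (intro CollectI exI[of _ j]) (simp add: c)
  qed
qed

lemma marked_next_mark:
  assumes "marked P h pc c" "j < 3"
  shows "semi_next A c j = (Mark j, if j \<in> A \<and> P j = h then
      (case instr pc of Push j' m m' pc' \<Rightarrow> if j' = j then move_cell h m else h | Walk _ _ _ _ \<Rightarrow> h)
    else P j)"
proof -
  have c: "c j = (Mark j, P j)"
    using assms by (auto simp: marked_def)
  show ?thesis
    using obs_marked(1)[OF assms(1)] by (auto simp: tstep_def c split: instr.split)
qed

lemma marked_next_head:
  assumes "marked P h pc c"
  shows "semi_next A c 3 = (if 3 \<in> A then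
      map_prod id (move_cell h) (semi_delta (Head pc) (obs 4 c h)) else (Head pc, h))"
  using assms by (auto simp: tstep_def marked_def map_prod_def split: prod.split)

text \<open>Here and in the next two lemmas, the conclusion has the form required by the fairness
  rule \<open>leads_enabled\<close>: one agent decides, whoever else is active.\<close>

lemma marked_push_mark:
  assumes "instr pc = Push j m m' pc'" "j < 3" "P j = h" "snd m \<noteq> 0" and c: "marked P h pc c"
  shows "if j \<in> A then marked (P(j := move_cell h m)) h pc (semi_next A c) else marked P h pc (semi_next A c)"
proof -
  have "semi_next A c 3 = (Head pc, h)"
    using assms(1-4) obs_marked(2)[OF c assms(2)] unfolding marked_next_head[OF c] by simp
  moreover have "semi_next A c i = (Mark i, if i = j \<and> j \<in> A then move_cell h m else P i)" if "i < 3" for i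
    using assms(1,3) unfolding marked_next_mark[OF c that] by simp
  ultimately show ?thesis by (simp add: marked_def)
qed

lemma marked_push_head:
  assumes "instr pc = Push j m m' pc'" "j < 3" "P j \<noteq> h \<or> snd m = 0" and c: "marked P h pc c"
  shows "if 3 \<in> A then marked P (move_cell h m') pc' (semi_next A c) else marked P h pc (semi_next A c)"
proof -
  have "semi_next A c 3 = (if 3 \<in> A then (Head pc', move_cell h m') else (Head pc, h))"
    using assms(1,3) unfolding marked_next_head[OF c]
    by (cases "P j = h") (simp_all add: obs_marked(2)[OF c assms(2)])
  moreover have "semi_next A c i = (Mark i, P i)" if "i < 3" for i
    using assms(1,3) unfolding marked_next_mark[OF c that] by (cases m) (simp; blast)
  ultimately show ?thesis by (simp add: marked_def)
qed

lemma marked_walk: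
  assumes "instr pc = Walk m j pc' pc0" "j < 3" and c: "marked P h pc c"
  shows "if 3 \<in> A then
      (if P j = h then marked P h (if P 0 = h then pc0 else pc') (semi_next A c)
       else marked P (move_cell h m) pc (semi_next A c))
    else marked P h pc (semi_next A c)"
proof -
  have "semi_next A c 3 = (if 3 \<in> A then
      (if P j = h then (Head (if P 0 = h then pc0 else pc'), h) else (Head pc, move_cell h m))
    else (Head pc, h))"
    using assms(1) unfolding marked_next_head[OF c]
    by (simp add: obs_marked(2)[OF c] obs_marked(2)[OF c assms(2)])
  moreover have "semi_next A c i = (Mark i, P i)" if "i < 3" for i
    using assms(1) unfolding marked_next_mark[OF c that] by simp
  ultimately show ?thesis by (simp add: marked_def)
qed

definition place :: "bool \<Rightarrow> cell \<Rightarrow> nat \<Rightarrow> nat \<Rightarrow> nat \<Rightarrow> cell" where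
  "place \<sigma> p y z = (\<lambda>i. if i = source \<sigma> then shift p (side \<sigma> * int y)
     else if i = source (\<not> \<sigma>) then shift p (- side \<sigma> * int z)
     else if i = 0 then p else origin)"

lemma place_simps [simp]:
  "place \<sigma> p y z 0 = p"
  "place \<sigma> p y z (source \<sigma>) = shift p (side \<sigma> * int y)"
  "place \<sigma> p y z (source (\<not> \<sigma>)) = shift p (- side \<sigma> * int z)"
  by (auto simp: place_def source_def)

lemma place_upd:
  "(place \<sigma> p y z)(source \<sigma> := shift p (side \<sigma> * int y')) = place \<sigma> p y' z"
  "(place \<sigma> p y z)(source (\<not> \<sigma>) := shift p (- side \<sigma> * int z')) = place \<sigma> p y z'"
  by (auto simp: place_def)

text \<open>No copying back is needed: the filled target simply serves as the next source.\<close>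

lemma place_swap: "place \<sigma> p y z = place (\<not> \<sigma>) p z y"
  by (auto simp: place_def)

definition semi_config :: "bool \<Rightarrow> 'c \<times> nat \<times> cell \<Rightarrow> (nat \<Rightarrow> 'c astate \<times> cell) \<Rightarrow> bool" where
  "semi_config \<sigma> = (\<lambda>(q, k, p). marked (place \<sigma> p k 0) p (PushBase (q, k mod L) \<sigma>))"

section \<open>Progress under fair schedules\<close>

context
  fixes sched :: "nat \<Rightarrow> nat set" and init :: "nat \<Rightarrow> 'c astate"
  assumes fair: "fair_sched 4 sched"
begin

text \<open>Relative to one fixed run, since the schedule depends on time. A visit at any time
  counts, so no order between \<open>t\<close> and \<open>t'\<close> is imposed.\<close>

definition leads ::
  "((nat \<Rightarrow> 'c astate \<times> cell) \<Rightarrow> bool) \<Rightarrow> ((nat \<Rightarrow> 'c astate \<times> cell) \<Rightarrow> bool) \<Rightarrow> bool" where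
  "leads X Y \<longleftrightarrow> (\<forall>t. X (trun 4 semi_delta init sched t) \<longrightarrow>
     (\<exists>t'. Y (trun 4 semi_delta init sched t')))"

lemma leads_refl [simp]: "leads X X"
  by (auto simp: leads_def)

lemma leads_trans [trans]: "leads X Y \<Longrightarrow> leads Y Z \<Longrightarrow> leads X Z"
  by (auto simp: leads_def)

text \<open>Fairness rule: \<open>X\<close> persists until agent \<open>i\<close> is next active,
  which fairness guarantees to happen, and that activation establishes \<open>Y\<close>.\<close>

lemma leads_enabled:
  assumes "i < 4" and "\<And>A c. X c \<Longrightarrow> if i \<in> A then Y (semi_next A c) else X (semi_next A c)"
  shows "leads X Y"
  unfolding leads_def
proof (intro allI impI)
  fix t assume X: "X (trun 4 semi_delta init sched t)"
  have "infinite {t. i \<in> sched t}"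
    using fair assms(1) by (auto simp: fair_sched_def)
  then obtain u where "u \<ge> t" "i \<in> sched u"
    unfolding finite_nat_set_iff_bounded_le by (auto simp: not_le intro: less_imp_le)
  then obtain d where "i \<in> sched (t + d)"
    by (metis le_Suc_ex)
  with X show "\<exists>t'. Y (trun 4 semi_delta init sched t')"
  proof (induction d arbitrary: t)
    case 0
    then show ?case using assms(2)[OF 0(1), of "sched t"] by (intro exI[of _ "Suc t"]) auto
  next
    case (Suc d)
    show ?case
    proof (cases "i \<in> sched t")
      case True
      then show ?thesis
        using assms(2)[OF Suc.prems(1), of "sched t"] by (intro exI[of _ "Suc t"]) auto
    next
      case False
      then show ?thesis
        using assms(2)[OF Suc.prems(1), of "sched t"] Suc.IH[of "Suc t"] Suc.prems(2) by auto
    qed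
  qed
qed

text \<open>Two fair steps: the mark leaves, which unblocks the head. If \<open>m\<close> is a stay,
  the head acts alone.\<close>

lemma leads_push:
  assumes pc: "instr pc = Push j m m' pc'" and j: "j < 3" "P j = h" and m: "fst m \<noteq> 0"
  shows "leads (marked P h pc) (marked (P(j := move_cell h m)) (move_cell h m') pc')"
proof (cases "snd m = 0")
  case True
  then have "P(j := move_cell h m) = P" using j by (cases m) auto
  then show ?thesis
    using marked_push_head[where P = P and h = h, OF pc j(1)] True by (intro leads_enabled[of 3]) auto
next
  case False
  have "leads (marked P h pc) (marked (P(j := move_cell h m)) h pc)"
  proof (rule leads_enabled)
    show "j < 4" using j(1) by simp
  qed (rule marked_push_mark[where P = P and h = h, OF pc j False])
  also have "leads \<dots> (marked (P(j := move_cell h m)) (move_cell h m') pc')"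
    using marked_push_head[where P = "P(j := move_cell h m)" and h = h, OF pc j(1)] move_cell_neq[OF False m]
    by (intro leads_enabled[of 3]) auto
  finally show ?thesis .
qed

lemma leads_walk:
  assumes pc: "instr pc = Walk (s, 1) j pc' pc0" and j: "j < 3" "P j = shift h (s * int d)" and s: "s \<noteq> 0"
  shows "leads (marked P h pc) (marked P (P j) (if P 0 = P j then pc0 else pc'))"
  using j(2)
proof (induction d arbitrary: h)
  case 0
  then have "P j = h" by simp
  then show ?case
    using marked_walk[OF pc j(1), of P h] by (intro leads_enabled[of 3]) auto
next
  case (Suc d)
  have "s * int (Suc d) \<noteq> 0" using s by simp
  then have "P j \<noteq> h" unfolding Suc.prems by (metis shift_eq_self(1))
  then have "if 3 \<in> A then marked P (shift h s) pc (semi_next A c) else marked P h pc (semi_next A c)"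
    if "marked P h pc c" for A c
    using marked_walk[OF pc j(1) that, of A] by (auto simp: move_cell_axis split: if_splits)
  then have "leads (marked P h pc) (marked P (shift h s) pc)"
    by (intro leads_enabled[of 3]) simp_all
  also have "leads \<dots> (marked P (P j) (if P 0 = P j then pc0 else pc'))"
    using Suc.prems by (intro Suc.IH) (auto simp: algebra_simps)
  finally show ?case .
qed

lemma leads_decr:
  assumes "den x = i + Suc d" and h': "h' = shift h (- side \<sigma> * int (Suc d))"
  shows "leads (marked (P(source \<sigma> := h)) h (Decr x \<sigma> s i)) (marked (P(source \<sigma> := h')) h' (WalkTarget x \<sigma> s))"
proof -
  define Q where "Q h = marked (P(source \<sigma> := h)) h" for h
  have push: "leads (Q h (Decr x \<sigma> s i)) (Q (shift h (- side \<sigma>))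
      (if Suc i < den x then Decr x \<sigma> s (Suc i) else (WalkTarget x \<sigma> s)))" for h i
    using leads_push[OF instr.simps(5)[of x \<sigma> s i], of "P(source \<sigma> := h)" h]
    by (simp add: move_cell_axis Q_def)
  have "leads (Q h (Decr x \<sigma> s i)) (Q (shift h (- side \<sigma> * int (Suc d))) (WalkTarget x \<sigma> s))"
    using assms(1)
  proof (induction d arbitrary: h i)
    case 0
    then show ?case using push[of h i] by simp
  next
    case (Suc d)
    from Suc.prems push[of h i]
    have "leads (Q h (Decr x \<sigma> s i)) (Q (shift h (- side \<sigma>)) (Decr x \<sigma> s (Suc i)))"
      by simp
    also have "leads \<dots> (Q (shift (shift h (- side \<sigma>)) (- side \<sigma> * int (Suc d))) (WalkTarget x \<sigma> s))"
      by (rule Suc.IH) (use Suc.prems in simp)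
    also have "shift (shift h (- side \<sigma>)) (- side \<sigma> * int (Suc d)) = shift h (- side \<sigma> * int (Suc (Suc d)))"
      by (simp add: algebra_simps)
    finally show ?case .
  qed
  then show ?thesis by (simp only: Q_def h')
qed

lemma leads_incr:
  assumes "num x = i + Suc d" and h': "h' = shift h (- side \<sigma> * int (Suc d))"
  shows "leads (marked (P(source (\<not> \<sigma>) := h)) h (Incr x \<sigma> s i)) (marked (P(source (\<not> \<sigma>) := h')) h' (WalkSource x \<sigma> ((s + num x) mod L)))"
proof -
  define Q where "Q h = marked (P(source (\<not> \<sigma>) := h)) h" for h
  have push: "leads (Q h (Incr x \<sigma> s i)) (Q (shift h (- side \<sigma>))
      (if Suc i < num x then Incr x \<sigma> s (Suc i) else (WalkSource x \<sigma> ((s + num x) mod L))))" for h i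
    using leads_push[OF instr.simps(7)[of x \<sigma> s i], of "P(source (\<not> \<sigma>) := h)" h]
    by (simp add: move_cell_axis Q_def)
  have "leads (Q h (Incr x \<sigma> s i)) (Q (shift h (- side \<sigma> * int (Suc d))) (WalkSource x \<sigma> ((s + num x) mod L)))"
    using assms(1)
  proof (induction d arbitrary: h i)
    case 0
    then show ?case using push[of h i] by simp
  next
    case (Suc d)
    from Suc.prems push[of h i]
    have "leads (Q h (Incr x \<sigma> s i)) (Q (shift h (- side \<sigma>)) (Incr x \<sigma> s (Suc i)))"
      by simp
    also have "leads \<dots> (Q (shift (shift h (- side \<sigma>)) (- side \<sigma> * int (Suc d))) (WalkSource x \<sigma> ((s + num x) mod L)))"
      by (rule Suc.IH) (use Suc.prems in simp)
    also have "shift (shift h (- side \<sigma>)) (- side \<sigma> * int (Suc d)) = shift h (- side \<sigma> * int (Suc (Suc d)))"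
      by (simp add: algebra_simps)
    finally show ?case .
  qed
  then show ?thesis by (simp only: Q_def h')
qed

lemma leads_walk_source:
  "leads (marked (place \<sigma> p y z) (shift p (- side \<sigma> * int z)) (WalkSource x \<sigma> s))
    (marked (place \<sigma> p y z) (shift p (side \<sigma> * int y))
      (if y = 0 then PushBase (nxt x, s) (\<not> \<sigma>) else Decr x \<sigma> s 0))"
  using leads_walk[OF instr.simps(8)[of x \<sigma> s], of "place \<sigma> p y z" "shift p (- side \<sigma> * int z)" "y + z"]
  by (simp add: algebra_simps)

lemma leads_collect:
  assumes "0 < num x"
  shows "leads (marked (place \<sigma> p y z) (shift p (- side \<sigma> * int z)) (Incr x \<sigma> s 0))
    (marked (place \<sigma> p y (z + num x)) (shift p (- side \<sigma> * int (z + num x)))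
      (WalkSource x \<sigma> ((s + num x) mod L)))"
proof -
  obtain b where b: "num x = Suc b" using assms by (metis gr0_implies_Suc)
  show ?thesis
    \<comment> \<open>Both target positions become updates of \<open>place \<sigma> p y z\<close>,
      the form of \<open>leads_incr\<close>.\<close>
    unfolding place_upd(2)[of \<sigma> p y z "z + num x", symmetric]
    by (subst place_upd(2)[of \<sigma> p y z z, symmetric], rule leads_incr[where d = b])
       (simp_all add: b algebra_simps)
qed

lemma leads_transfer_once:
  assumes "x \<in> K \<times> {..<L}"
  shows "leads
    (marked (place \<sigma> p (y + den x) z) (shift p (side \<sigma> * int (y + den x))) (Decr x \<sigma> s 0))
    (marked (place \<sigma> p y (z + num x)) (shift p (side \<sigma> * int y))
      (if y = 0 then PushBase (nxt x, (s + num x) mod L) (\<not> \<sigma>)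
       else Decr x \<sigma> ((s + num x) mod L) 0))"
proof -
  obtain a where a: "den x = Suc a"
    using den[OF assms] by (metis gr0_implies_Suc)
  let ?u = "(s + num x) mod L"
  have "leads (marked (place \<sigma> p (y + den x) z) (shift p (side \<sigma> * int (y + den x))) (Decr x \<sigma> s 0))
      (marked (place \<sigma> p y z) (shift p (side \<sigma> * int y)) (WalkTarget x \<sigma> s))"
    unfolding place_upd(1)[of \<sigma> p "y + den x" z y, symmetric]
    by (subst place_upd(1)[of \<sigma> p "y + den x" z "y + den x", symmetric], rule leads_decr[where d = a])
       (simp_all add: a algebra_simps)
  also have "leads \<dots> (marked (place \<sigma> p y z) (shift p (- side \<sigma> * int z)) (Incr x \<sigma> s 0))"
    using leads_walk[OF instr.simps(6)[of x \<sigma> s], of "place \<sigma> p y z" "shift p (side \<sigma> * int y)" "y + z"]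
    by (simp add: algebra_simps)
  also have "leads \<dots> (marked (place \<sigma> p y (z + num x)) (shift p (- side \<sigma> * int (z + num x)))
      (WalkSource x \<sigma> ?u))"
    using num[OF assms] by (intro leads_collect) simp
  also note leads_walk_source
  finally show ?thesis .
qed

text \<open>The zero test comes after a batch, so the source must hold at least one; hence
  \<open>Suc j\<close>.\<close>

lemma leads_transfer:
  assumes "x \<in> K \<times> {..<L}"
  shows "leads
    (marked (place \<sigma> p (den x * Suc j) z) (shift p (side \<sigma> * int (den x * Suc j))) (Decr x \<sigma> s 0))
    (marked (place \<sigma> p 0 (z + num x * Suc j)) p
      (PushBase (nxt x, (s + num x * Suc j) mod L) (\<not> \<sigma>)))"
proof (induction j arbitrary: s z)
  case 0
  show ?case using leads_transfer_once[OF assms, of \<sigma> p 0 z s] by simp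
next
  case (Suc j)
  have nz: "den x * Suc j \<noteq> 0" using den[OF assms] by simp
  have e: "den x * Suc (Suc j) = den x * Suc j + den x" by simp
  have "leads
    (marked (place \<sigma> p (den x * Suc (Suc j)) z) (shift p (side \<sigma> * int (den x * Suc (Suc j)))) (Decr x \<sigma> s 0))
    (marked (place \<sigma> p (den x * Suc j) (z + num x)) (shift p (side \<sigma> * int (den x * Suc j)))
      (Decr x \<sigma> ((s + num x) mod L) 0))"
    using leads_transfer_once[OF assms, of \<sigma> p "den x * Suc j" z s] unfolding e by (simp only: nz if_False)
  also note Suc.IH
  also have "((s + num x) mod L + num x * Suc j) mod L = (s + num x * Suc (Suc j)) mod L"
    by (simp only: mod_add_left_eq mult_Suc_right add.assoc)
  also have "z + num x + num x * Suc j = z + num x * Suc (Suc j)" by simp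
  finally show ?case .
qed

text \<open>Base and target are displaced while the head is with them, the source once the head has
  reached it. The offsets are then intact, and the transfer takes place around the new base.\<close>

lemma semi_step:
  assumes "valid s"
  shows "leads (semi_config \<sigma> s) (semi_config (\<not> \<sigma>) (robot_step s))"
proof -
  obtain q k p where s: "s = (q, k, p)" by (cases s)
  define x p' where "x = (q, k mod L)" and "p' = move_cell p (mv x)"
  have xK: "x \<in> K \<times> {..<L}" using assms L by (auto simp: s valid_def x_def)
  have m: "fst (mv x) \<noteq> 0" using mv[OF xK] by auto
  have "den x dvd k" "0 < k" using assms den_dvd[of q k] by (auto simp: s valid_def x_def)
  then obtain j where kj: "k = den x * Suc j"
    by (metis dvd_def gr0_implies_Suc nat_0_less_mult_iff)
  let ?P = "place \<sigma> p k 0" and ?P1 = "(place \<sigma> p k 0)(0 := p')"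
  let ?P2 = "(place \<sigma> p k 0)(0 := p', source (\<not> \<sigma>) := p')"
  let ?h = "shift p (side \<sigma> * int k)" and ?h' = "shift p' (side \<sigma> * int k)"
  have P2: "?P2(source \<sigma> := ?h') = place \<sigma> p' k 0"
    by (auto simp: place_def source_def)
  have "leads (marked ?P p (PushBase x \<sigma>)) (marked ?P1 p (PushTarget x \<sigma>))"
    using leads_push[OF instr.simps(1)[of x \<sigma>], of ?P p] m by (simp add: p'_def)
  also have "leads \<dots> (marked ?P2 p (WalkOut x \<sigma>))"
    using leads_push[OF instr.simps(2)[of x \<sigma>], of ?P1 p] m by (simp add: p'_def)
  also have "leads \<dots> (marked ?P2 ?h (PushSource x \<sigma>))"
    using leads_walk[OF instr.simps(3)[of x \<sigma>], of ?P2 p k] by simp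
  also have "leads \<dots> (marked (place \<sigma> p' k 0) ?h' (Decr x \<sigma> 0 0))"
    using leads_push[OF instr.simps(4)[of x \<sigma>], of ?P2 ?h] m P2
    by (simp add: move_cell_shift p'_def)
  also have "leads \<dots> (marked (place \<sigma> p' 0 (num x * Suc j)) p'
      (PushBase (nxt x, (num x * Suc j) mod L) (\<not> \<sigma>)))"
    using leads_transfer[OF xK, of \<sigma> p' j 0 0] unfolding kj by simp
  also have "\<dots> = semi_config (\<not> \<sigma>) (nxt x, num x * Suc j, p')"
    unfolding place_swap[of \<sigma>] by (simp add: semi_config_def)
  also have "(nxt x, num x * Suc j, p') = (nxt x, k div den x * num x, p')"
    using den[OF xK] kj by simp
  also have "\<dots> = robot_step s"
    by (simp add: s robot_step_def p'_def x_def Let_def)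
  finally show ?thesis by (simp add: s semi_config_def x_def)
qed

lemma semi_reach:
  assumes "reach s s'" "valid s"
  shows "\<exists>\<sigma>'. leads (semi_config \<sigma> s) (semi_config \<sigma>' s')"
  using assms(1)
proof (induction rule: reach_induct)
  case refl
  show ?case using leads_refl by blast
next
  case (step y)
  then show ?case using leads_trans semi_step[OF valid_reach[OF step(1) assms(2)]] by blast
qed

end

text \<open>The protocol starts in the middle of a transfer, with an empty source.\<close>

lemma semi_exploration:
  assumes "ini \<in> K" "num (ini, 0) = 1"
    and visits: "\<And>c. is_cell n c \<Longrightarrow> \<exists>q k. reach (nxt (ini, 0), 1, origin) (q, k, c)"
  shows "\<exists>Q \<delta> init. protocol n 4 Q \<delta> init \<and> (\<forall>sched. fair_sched 4 sched \<longrightarrow> explores n 4 \<delta> init sched)"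
proof -
  define init :: "nat \<Rightarrow> 'c astate" where
    "init i = (if i < 3 then Mark i else Head (Incr (ini, 0) True 0 0))" for i
  let ?s = "(nxt (ini, 0), 1, origin)"
  have val: "valid ?s"
    using assms(1) nxt L by (auto simp: valid_def)
  have "explores n 4 (encode semi_delta) (to_nat \<circ> init) sched" if fair: "fair_sched 4 sched" for sched
  proof (rule explores_encode)
    fix c assume c: "is_cell n c"
    define R where "R = trun 4 semi_delta init sched"
    let ?P = "place True origin 0 0"
    have "marked ?P origin (Incr (ini, 0) True 0 0) (R 0)"
      by (simp add: marked_def R_def init_def place_def source_def)
    moreover have "leads sched init (marked ?P origin (Incr (ini, 0) True 0 0))
        (marked (place True origin 0 1) (shift origin (- 1)) (WalkSource (ini, 0) True ((0 + num (ini, 0)) mod L)))"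
      using leads_collect[OF fair, of "(ini, 0)" init True origin 0 0 0] assms(2)
      by (simp add: side_def)
    \<comment> \<open>The empty source stands on mark 0, so the transfer ends at once and mark 2, at
      distance 1, becomes the source.\<close>
    moreover have "leads sched init \<dots> (semi_config False ?s)"
      using leads_walk_source[OF fair, of init True origin 0 1 "(ini, 0)" "(0 + num (ini, 0)) mod L"]
      by (simp add: assms(2) semi_config_def place_swap[of True] side_def)
    ultimately obtain t where t: "semi_config False ?s (R t)"
      unfolding leads_def[OF fair] R_def by blast
    obtain q k where "reach ?s (q, k, c)"
      using visits[OF c] by blast
    from semi_reach[OF fair this val, of init False] t
    obtain \<sigma> t' where "semi_config \<sigma> (q, k, c) (R t')"
      unfolding leads_def[OF fair] R_def by blast
    then have "snd (R t' 0) = c" by (simp add: semi_config_def marked_def)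
    then show "\<exists>t. \<exists>i<4. snd (trun 4 semi_delta init sched t i) = c"
      unfolding R_def by (intro exI[of _ t'] exI[of _ 0]) simp
  qed
  moreover have "protocol n 4 (to_nat ` (Mark ` {..<3} \<union> Head ` pcs)) (encode semi_delta) (to_nat \<circ> init)"
    using assms(1) L finite_pcs semi_delta_closed
    by (intro protocol_encode) (auto simp: init_def)
  ultimately show ?thesis by blast
qed

end

section \<open>A robot exploring the grid\<close>

text \<open>The exponents of \<open>P (2 * d)\<close> and \<open>P (2 * d + 1)\<close> in the register are the numbers of steps
  that remain and that have been made along axis \<open>d\<close> in a sweep of a box. State \<open>Up d\<close> means that
  the axes below \<open>d\<close> have been swept completely; \<open>Down d\<close> brings the robot back along axis \<open>d\<close>;
  after the whole box has been swept, \<open>Out\<close> moves its corner by \<open>-1\<close> and enlarges it by 2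
  along all axes.\<close>

datatype ctl = Init | Up nat | Down nat | Out nat

instance ctl :: countable
  by countable_datatype

locale sweeping =
  fixes n :: nat and P :: "nat \<Rightarrow> nat"
  assumes n1: "n \<ge> 1" and prime_P: "\<And>i. prime (P i)" and inj_P: "inj P"
begin

text \<open>The indices are the pairs \<open>2 * d\<close>, \<open>2 * d + 1\<close> for the axes
  \<open>d\<close> from 1 to \<open>n\<close>.\<close>

definition modulus :: nat where
  "modulus = (\<Prod>i\<in>{2..<2 * n + 2}. P i)"

definition reg :: "(nat \<Rightarrow> nat) \<Rightarrow> nat" where
  "reg e = (\<Prod>i\<in>{2..<2 * n + 2}. P i ^ e i)"

definition ctls :: "ctl set" where
  "ctls = insert Init (Up ` {1..Suc n} \<union> Down ` {1..n} \<union> Out ` {1..Suc n})"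

fun sden :: "ctl \<times> nat \<Rightarrow> nat" where
  "sden (Up d, r) = (if d \<le> n \<and> P (2 * d) dvd r then P (2 * d) else 1)"
| "sden (Down d, r) = (if P (2 * d + 1) dvd r then P (2 * d + 1) else 1)"
| "sden _ = 1"

fun snum :: "ctl \<times> nat \<Rightarrow> nat" where
  "snum (Up d, r) = (if d \<le> n \<and> P (2 * d) dvd r then P (2 * d + 1) else 1)"
| "snum (Down d, r) = (if P (2 * d + 1) dvd r then P (2 * d) else 1)"
| "snum (Out d, r) = (if d \<le> n then P (2 * d) ^ 2 else 1)"
| "snum (Init, r) = 1"

fun smv :: "ctl \<times> nat \<Rightarrow> move" where
  "smv (Up d, r) = (if d \<le> n \<and> P (2 * d) dvd r then (1, d) else (1, 0))"
| "smv (Down d, r) = (if P (2 * d + 1) dvd r then (-1, d) else (1, 0))"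
| "smv (Out d, r) = (if d \<le> n then (-1, d) else (1, 0))"
| "smv (Init, r) = (-1, 1)"

fun snxt :: "ctl \<times> nat \<Rightarrow> ctl" where
  "snxt (Up d, r) = (if d > n then Out 1 else if P (2 * d) dvd r then Up 1 else Down d)"
| "snxt (Down d, r) = (if P (2 * d + 1) dvd r then Down d else Up (Suc d))"
| "snxt (Out d, r) = (if d \<le> n then Out (Suc d) else Up 1)"
| "snxt (Init, r) = Up 1"

lemma P_pos: "0 < P i"
  using prime_P by (simp add: prime_gt_0_nat)

lemma modulus_pos: "0 < modulus"
  by (auto simp: modulus_def P_pos intro!: prod_pos)

lemma P_dvd_modulus: "i \<in> {2..<2 * n + 2} \<Longrightarrow> P i dvd modulus"
  unfolding modulus_def by (intro dvd_prodI) auto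

lemma P_le_modulus: "i \<in> {2..<2 * n + 2} \<Longrightarrow> P i \<le> modulus"
  using P_dvd_modulus modulus_pos by (simp add: dvd_imp_le)

lemma square_bound: "a \<le> modulus \<Longrightarrow> a \<le> modulus\<^sup>2"
  using modulus_pos by (simp add: power2_eq_square) (meson le_square le_trans)

text \<open>The bound is a square because \<open>Out\<close> multiplies by
  \<open>P (2 * d) ^ 2\<close>.\<close>

sublocale fraction_robot n modulus "modulus\<^sup>2" ctls sden snum smv snxt
proof
  have even: "2 * d \<in> {2..<2 * n + 2}" and odd: "2 * d + 1 \<in> {2..<2 * n + 2}" if "d \<in> {1..n}" for d
    using that by auto
  note P_even = P_dvd_modulus[OF even] P_le_modulus[OF even]
  note P_odd = P_dvd_modulus[OF odd] P_le_modulus[OF odd]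
  fix x assume "x \<in> ctls \<times> {..<modulus}"
  then obtain q r where x: "x = (q, r)" and q: "q \<in> ctls" by auto
  show "0 < sden x \<and> sden x \<le> modulus\<^sup>2 \<and> sden x dvd modulus \<and> sden x dvd snd x"
    using q P_even P_odd P_pos modulus_pos square_bound unfolding x ctls_def
    by (cases q) (auto simp: Suc_le_eq)
  show "0 < snum x \<and> snum x \<le> modulus\<^sup>2"
    using q P_even P_odd P_pos modulus_pos square_bound unfolding x ctls_def
    by (cases q) (auto simp: Suc_le_eq intro!: power_mono)
  show "fst (smv x) \<in> {-1, 1} \<and> snd (smv x) \<le> n"
    using q n1 unfolding x ctls_def by (cases q) auto
  show "snxt x \<in> ctls"
    using q n1 unfolding x ctls_def by (cases q) auto
qed (use n1 modulus_pos in \<open>auto simp: ctls_def\<close>)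

section \<open>Counters as exponents of primes\<close>

lemma reg_Suc: "i \<in> {2..<2 * n + 2} \<Longrightarrow> reg (e(i := Suc a)) = P i * reg (e(i := a))"
  unfolding reg_def by (subst (1 2) prod.remove[of _ i]) (auto intro!: prod.cong)

lemma reg_0: "reg (\<lambda>_. 0) = 1"
  by (simp add: reg_def)

lemma reg_cong: "(\<And>i. i \<in> {2..<2 * n + 2} \<Longrightarrow> e i = e' i) \<Longrightarrow> reg e = reg e'"
  by (simp add: reg_def)

text \<open>The zero test of a counter: the primes are distinct, and each divides
  \<open>modulus\<close>, so the residue suffices.\<close>

lemma P_dvd_reg:
  assumes "i \<in> {2..<2 * n + 2}"
  shows "P i dvd reg e mod modulus \<longleftrightarrow> e i \<noteq> 0"
proof -
  have "P i dvd reg e mod modulus \<longleftrightarrow> P i dvd reg e"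
    using P_dvd_modulus[OF assms] by (simp add: dvd_mod_iff)
  also have "\<dots> \<longleftrightarrow> (\<exists>j\<in>{2..<2 * n + 2}. P i dvd P j ^ e j)"
    unfolding reg_def by (rule prime_dvd_prod_iff) (simp_all add: prime_P)
  also have "\<dots> \<longleftrightarrow> (\<exists>j\<in>{2..<2 * n + 2}. i = j \<and> 0 < e j)"
  proof -
    have "P i dvd P j ^ e j \<longleftrightarrow> i = j \<and> 0 < e j" for j
      using prime_gt_1_nat[OF prime_P, of i] primes_dvd_imp_eq[OF prime_P prime_P, of i j] inj_P
      by (cases "e j = 0") (auto simp: prime_dvd_power_iff[OF prime_P] inj_eq)
    then show ?thesis by simp
  qed
  finally show ?thesis using assms by auto
qed

lemma step_up:
  assumes d: "d \<in> {1..n}" and e: "e (2 * d) = Suc a"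
  shows "robot_step (Up d, reg e, p) =
    (Up 1, reg (e(2 * d := a, 2 * d + 1 := Suc (e (2 * d + 1)))), p(d := p d + 1))"
proof -
  have i: "2 * d \<in> {2..<2 * n + 2}" "2 * d + 1 \<in> {2..<2 * n + 2}" using d by auto
  have "reg e = P (2 * d) * reg (e(2 * d := a))"
    using reg_Suc[OF i(1), of e a] e by (metis fun_upd_triv)
  moreover have "reg (e(2 * d := a, 2 * d + 1 := Suc (e (2 * d + 1)))) = P (2 * d + 1) * reg (e(2 * d := a))"
    using reg_Suc[OF i(2), of "e(2 * d := a)" "e (2 * d + 1)"] by (simp add: fun_upd_idem)
  ultimately show ?thesis
    using d P_dvd_reg[OF i(1), of e] e P_pos[of "2 * d"]
    by (simp add: robot_step_def Let_def move_cell_def mult.commute)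
qed

lemma step_turn:
  assumes "d \<in> {1..n}" and "e (2 * d) = 0"
  shows "robot_step (Up d, reg e, p) = (Down d, reg e, p)"
  using assms P_dvd_reg[of "2 * d" e] by (simp add: robot_step_def Let_def)

lemma step_down:
  assumes d: "d \<in> {1..n}" and e: "e (2 * d + 1) = Suc a"
  shows "robot_step (Down d, reg e, p) =
    (Down d, reg (e(2 * d := Suc (e (2 * d)), 2 * d + 1 := a)), p(d := p d - 1))"
proof -
  have i: "2 * d \<in> {2..<2 * n + 2}" "2 * d + 1 \<in> {2..<2 * n + 2}" using d by auto
  have "reg e = P (2 * d + 1) * reg (e(2 * d + 1 := a))"
    using reg_Suc[OF i(2), of e a] e by (metis fun_upd_triv)
  moreover have "reg (e(2 * d + 1 := a, 2 * d := Suc (e (2 * d)))) = P (2 * d) * reg (e(2 * d + 1 := a))"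
    using reg_Suc[OF i(1), of "e(2 * d + 1 := a)" "e (2 * d)"] by (simp add: fun_upd_idem)
  moreover have "e(2 * d := Suc (e (2 * d)), 2 * d + 1 := a) = e(2 * d + 1 := a, 2 * d := Suc (e (2 * d)))"
    by (simp add: fun_upd_twist)
  ultimately show ?thesis
    using d P_dvd_reg[OF i(2), of e] e P_pos[of "2 * d + 1"]
    by (simp add: robot_step_def Let_def move_cell_def mult.commute)
qed

lemma step_back:
  assumes "d \<in> {1..n}" and "e (2 * d + 1) = 0"
  shows "robot_step (Down d, reg e, p) = (Up (Suc d), reg e, p)"
  using assms P_dvd_reg[of "2 * d + 1" e] by (simp add: robot_step_def Let_def)

lemma step_out:
  assumes d: "d \<in> {1..n}"
  shows "robot_step (Out d, reg e, p) =
    (Out (Suc d), reg (e(2 * d := Suc (Suc (e (2 * d))))), p(d := p d - 1))"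
proof -
  have i: "2 * d \<in> {2..<2 * n + 2}" using d by auto
  show ?thesis
    using d reg_Suc[OF i, of e "Suc (e (2 * d))"] reg_Suc[OF i, of e "e (2 * d)"]
    by (simp add: robot_step_def Let_def move_cell_def power2_eq_square)
qed

text \<open>Induction on the number of axes. An inner sweep returns to its start with the register
  restored, so it can be repeated after each step along the next axis; walking back along that axis
  restores its own two counters.\<close>

lemma sweep:
  assumes "d \<le> n" "\<And>i. i \<in> {1..d} \<Longrightarrow> e (2 * i + 1) = 0"
  shows "reach (Up 1, reg e, p) (Up (Suc d), reg e, p)"
    and "(\<And>i. y i \<le> (if i \<in> {1..d} then e (2 * i) else 0)) \<Longrightarrow>
      \<exists>q k. reach (Up 1, reg e, p) (q, k, \<lambda>i. p i + int (y i))"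
proof -
  have "reach (Up 1, reg e, p) (Up (Suc d), reg e, p) \<and>
    (\<forall>y. (\<forall>i. y i \<le> (if i \<in> {1..d} then e (2 * i) else 0)) \<longrightarrow>
      (\<exists>q k. reach (Up 1, reg e, p) (q, k, \<lambda>i. p i + int (y i))))"
    using assms
  proof (induction d arbitrary: e p)
    case 0
    have "\<exists>q k. reach (Up 1, reg e, p) (q, k, \<lambda>i. p i + int (y i))" if "\<forall>i. y i = 0" for y
      by (intro exI[of _ "Up 1"] exI[of _ "reg e"]) (simp add: that)
    then show ?case by simp
  next
    case (Suc d)
    define D where "D = Suc d"
    define N where "N = e (2 * D)"
    have D: "D \<in> {1..n}" using Suc.prems(1) by (simp add: D_def)
    \<comment> \<open>Counters \<open>E j\<close> and position \<open>B j\<close> after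
      \<open>j\<close> steps along axis \<open>D\<close>.\<close>
    define E where "E j = e(2 * D := N - j, 2 * D + 1 := j)" for j
    define B where "B j = p(D := p D + int j)" for j
    have E0: "E 0 = e" and B0: "B 0 = p"
      using Suc.prems(2)[of D] by (auto simp: E_def N_def B_def D_def fun_eq_iff)
    \<comment> \<open>All \<open>E j\<close> agree on the counters of the axes below
      \<open>D\<close>, so the induction hypothesis applies for every \<open>j\<close>.\<close>
    have inner: "reach (Up 1, reg (E j), B j) (Up D, reg (E j), B j)"
      and inner_visits: "(\<And>i. y i \<le> (if i \<in> {1..d} then E j (2 * i) else 0)) \<Longrightarrow>
        \<exists>q k. reach (Up 1, reg (E j), B j) (q, k, \<lambda>i. B j i + int (y i))" for j y
    proof -
      have "E j (2 * i + 1) = 0" if "i \<in> {1..d}" for i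
      proof -
        have "2 * i + 1 \<noteq> 2 * D" by presburger
        then show ?thesis using that Suc.prems(2)[of i] by (simp add: E_def D_def)
      qed
      from Suc.IH[of "E j" "B j", OF _ this] Suc.prems(1)
      show "reach (Up 1, reg (E j), B j) (Up D, reg (E j), B j)"
        and "(\<And>i. y i \<le> (if i \<in> {1..d} then E j (2 * i) else 0)) \<Longrightarrow>
          \<exists>q k. reach (Up 1, reg (E j), B j) (q, k, \<lambda>i. B j i + int (y i))"
        by (auto simp: D_def)
    qed
    have up: "reach (Up 1, reg e, p) (Up 1, reg (E j), B j)" if "j \<le> N" for j
      using that
    proof (induction j)
      case 0
      show ?case by (simp add: E0 B0)
    next
      case (Suc j)
      then have "reach (Up 1, reg e, p) (Up 1, reg (E j), B j)" by simp
      also note inner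
      also have "reach (Up D, reg (E j), B j) (Up 1, reg (E (Suc j)), B (Suc j))"
      proof (rule reach_step)
        have "E j (2 * D) = Suc (N - Suc j)" using Suc.prems by (simp add: E_def)
        moreover have "(E j)(2 * D := N - Suc j, 2 * D + 1 := Suc (E j (2 * D + 1))) = E (Suc j)"
          by (auto simp: E_def fun_eq_iff)
        moreover have "(B j)(D := B j D + 1) = B (Suc j)"
          by (auto simp: B_def fun_eq_iff)
        ultimately show "robot_step (Up D, reg (E j), B j) = (Up 1, reg (E (Suc j)), B (Suc j))"
          using step_up[OF D, of "E j" "N - Suc j" "B j"] by simp
      qed
      finally show ?case .
    qed
    have down: "reach (Down D, reg (E j), B j) (Down D, reg e, p)" if "j \<le> N" for j
      using that
    proof (induction j)
      case 0
      show ?case by (simp add: E0 B0)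
    next
      case (Suc j)
      have "reach (Down D, reg (E (Suc j)), B (Suc j)) (Down D, reg (E j), B j)"
      proof (rule reach_step)
        have "E (Suc j) (2 * D + 1) = Suc j" by (simp add: E_def)
        moreover have "(E (Suc j))(2 * D := Suc (E (Suc j) (2 * D)), 2 * D + 1 := j) = E j"
          using Suc.prems by (auto simp: E_def fun_eq_iff)
        moreover have "(B (Suc j))(D := B (Suc j) D - 1) = B j"
          by (auto simp: B_def fun_eq_iff)
        ultimately show "robot_step (Down D, reg (E (Suc j)), B (Suc j)) = (Down D, reg (E j), B j)"
          using step_down[OF D, of "E (Suc j)" j "B (Suc j)"] by simp
      qed
      also have "reach \<dots> (Down D, reg e, p)" using Suc by simp
      finally show ?case .
    qed
    have "reach (Up 1, reg e, p) (Up 1, reg (E N), B N)" by (rule up) simp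
    also note inner
    also have "reach (Up D, reg (E N), B N) (Down D, reg (E N), B N)"
      by (intro reach_step step_turn D) (simp add: E_def)
    also have "reach \<dots> (Down D, reg e, p)" by (rule down) simp
    also have "reach \<dots> (Up (Suc D), reg e, p)"
      using Suc.prems(2)[of D] by (intro reach_step step_back D) (simp add: D_def)
    finally have "reach (Up 1, reg e, p) (Up (Suc D), reg e, p)" .
    moreover have "\<exists>q k. reach (Up 1, reg e, p) (q, k, \<lambda>i. p i + int (y i))"
      if y: "\<forall>i. y i \<le> (if i \<in> {1..D} then e (2 * i) else 0)" for y
    proof -
      \<comment> \<open>The cell is met in the inner sweep that starts after \<open>y D\<close>
        steps along axis \<open>D\<close>.\<close>
      define j where "j = y D"
      have j: "j \<le> N" using spec[OF y, of D] by (simp add: j_def N_def D_def)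
      have "(y(D := 0)) i \<le> (if i \<in> {1..d} then E j (2 * i) else 0)" for i
      proof -
        have "2 * i \<noteq> 2 * D + 1" by presburger
        then show ?thesis using spec[OF y, of i] by (auto simp: E_def D_def split: if_splits)
      qed
      from inner_visits[OF this] obtain q k where
        "reach (Up 1, reg (E j), B j) (q, k, \<lambda>i. B j i + int ((y(D := 0)) i))" by blast
      also have "(\<lambda>i. B j i + int ((y(D := 0)) i)) = (\<lambda>i. p i + int (y i))"
        by (auto simp: B_def j_def)
      finally show ?thesis using reach_trans[OF up[OF j]] by blast
    qed
    ultimately show ?case by (simp only: D_def) blast
  qed
  then show "reach (Up 1, reg e, p) (Up (Suc d), reg e, p)"
    and "(\<And>i. y i \<le> (if i \<in> {1..d} then e (2 * i) else 0)) \<Longrightarrow>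
      \<exists>q k. reach (Up 1, reg e, p) (q, k, \<lambda>i. p i + int (y i))"
    by blast+
qed

section \<open>Growing boxes\<close>

definition box :: "nat \<Rightarrow> nat \<Rightarrow> nat" where
  "box N = (\<lambda>i. if even i then 2 * N else 0)"

text \<open>Lowest corner of the cube of radius \<open>N\<close> around \<open>p\<close>, whose side
  lengths are in \<open>box N\<close>.\<close>

definition corner :: "cell \<Rightarrow> nat \<Rightarrow> cell" where
  "corner p N = (\<lambda>i. if i \<in> {1..n} then p i - int N else p i)"

text \<open>A full sweep restores the register before \<open>Out\<close> begins; lowering the corner
  by 1 and lengthening the sides by 2 keeps the cube centred.\<close>

lemma grow: "reach (Up 1, reg (box N), corner p N) (Up 1, reg (box (Suc N)), corner p (Suc N))"
proof -
  define E where "E d = (\<lambda>i. if even i \<and> i div 2 \<in> {1..d} then 2 * Suc N else box N i)" for d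
  define B where "B d = (\<lambda>i. if i \<in> {1..d} then p i - int (Suc N) else corner p N i)" for d
  have out: "reach (Out 1, reg (box N), corner p N) (Out (Suc d), reg (E d), B d)" if "d \<le> n" for d
    using that
  proof (induction d)
    case 0
    have "E 0 = box N" "B 0 = corner p N" by (auto simp: E_def B_def)
    then show ?case by simp
  next
    case (Suc d)
    then have "reach (Out 1, reg (box N), corner p N) (Out (Suc d), reg (E d), B d)" by simp
    also have "reach \<dots> (Out (Suc (Suc d)), reg (E (Suc d)), B (Suc d))"
    proof (rule reach_step)
      have "(E d)(2 * Suc d := Suc (Suc (E d (2 * Suc d)))) = E (Suc d)"
      proof
        fix i
        have "i = 2 * Suc d \<longleftrightarrow> even i \<and> i div 2 = Suc d" by auto
        then show "((E d)(2 * Suc d := Suc (Suc (E d (2 * Suc d))))) i = E (Suc d) i"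
          by (cases "i = 2 * Suc d") (auto simp: E_def box_def)
      qed
      moreover have "(B d)(Suc d := B d (Suc d) - 1) = B (Suc d)"
        using Suc.prems by (auto simp: B_def corner_def fun_eq_iff)
      ultimately show "robot_step (Out (Suc d), reg (E d), B d) =
          (Out (Suc (Suc d)), reg (E (Suc d)), B (Suc d))"
        using step_out[of "Suc d" "E d" "B d"] Suc.prems by simp
    qed
    finally show ?case .
  qed
  have "reach (Up 1, reg (box N), corner p N) (Up (Suc n), reg (box N), corner p N)"
    by (rule sweep) (auto simp: box_def)
  also have "reach \<dots> (Out 1, reg (box N), corner p N)"
    by (rule reach_step) (simp add: robot_step_def Let_def)
  also have "reach \<dots> (Out (Suc n), reg (E n), B n)"
    by (rule out) simp
  also have "reach \<dots> (Up 1, reg (E n), B n)"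
    by (rule reach_step) (simp add: robot_step_def Let_def)
  also have "reg (E n) = reg (box (Suc N))"
    by (rule reg_cong) (auto simp: E_def box_def)
  also have "B n = corner p (Suc N)"
    by (auto simp: B_def corner_def)
  finally show ?thesis .
qed

lemma reach_box: "reach (Up 1, 1, p) (Up 1, reg (box N), corner p N)"
proof (induction N)
  case 0
  have "corner p 0 = p" "reg (box 0) = 1" by (auto simp: corner_def box_def reg_0 cong: if_cong)
  then show ?case by simp
next
  case (Suc N)
  then show ?case using grow reach_trans by blast
qed

text \<open>The start \<open>p\<close> is general because the synchronous robot starts beside the
  origin.\<close>

lemma visits:
  assumes "is_cell n p" "is_cell n c"
  shows "\<exists>q k. reach (Up 1, 1, p) (q, k, c)"
proof -
  \<comment> \<open>A radius for which the cube around \<open>p\<close> contains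
    \<open>c\<close>.\<close>
  define N where "N = nat (\<Sum>i\<in>{1..n}. \<bar>c i - p i\<bar>)"
  have N: "\<bar>c i - p i\<bar> \<le> int N" if "i \<in> {1..n}" for i
    using member_le_sum[OF that, of "\<lambda>i. \<bar>c i - p i\<bar>"] by (simp add: N_def)
  define y where "y i = (if i \<in> {1..n} then nat (c i - p i + int N) else 0)" for i
  have "\<exists>q k. reach (Up 1, reg (box N), corner p N) (q, k, \<lambda>i. corner p N i + int (y i))"
  proof (rule sweep)
    fix i show "y i \<le> (if i \<in> {1..n} then box N (2 * i) else 0)"
      using N[of i] by (auto simp: y_def box_def)
  qed (auto simp: box_def)
  moreover have "corner p N i + int (y i) = c i" for i
    using N[of i] assms by (auto simp: y_def corner_def is_cell_def)
  ultimately show ?thesis using reach_trans[OF reach_box] by simp blast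
qed

end

theorem theorem1p1:
  fixes n :: nat
  assumes "n \<ge> 1"
  shows "(\<exists>Q \<delta> init. protocol n 3 Q \<delta> init \<and> explores n 3 \<delta> init (sync_sched 3))
       \<and> (\<exists>Q \<delta> init. protocol n 4 Q \<delta> init \<and>
            (\<forall>sched. fair_sched 4 sched \<longrightarrow> explores n 4 \<delta> init sched))"
proof -
  obtain P :: "nat \<Rightarrow> nat" where "inj P" "range P \<subseteq> {p. prime p}"
    using infinite_countable_subset[OF primes_infinite] by blast
  then interpret sweeping n P
    using assms by unfold_locales auto
  have "Init \<in> ctls" by (simp add: ctls_def)
  moreover have "is_cell n origin" "is_cell n (shift origin (-1))"
    using assms by (auto simp: is_cell_def origin_def shift_def)
  ultimately show ?thesis
    using visits by (intro conjI sync_exploration[of Init] semi_exploration[of Init]) auto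
qed

end
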